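(* Let $\mathcal{G}=(\mathcal{V},\mathcal{E})$ be an undirected graph on $n\ge 2$ nodes, let $k>0$, and let $\Delta_1\ge\Delta_2$ be the largest and second largest degrees of nodes of $\mathcal{G}$. Consider the attacker-defender game with payoff $J_1(\mathfrak{F},\mathfrak{D})$ in which there is one attacked node and one defense node ($|\mathfrak{F}|=|\mathfrak{D}|=1$). Then there exists a Nash equilibrium if and only if $$k\le \frac{\Delta_1-\Delta_2}{\Delta_2+1}.$$ In this case the game value is $J^*=\frac{\Delta_1+1}{2k+2}$, and the Nash equilibrium strategy is that both the attacker and the defender choose the node with the largest degree.
   Context: $\mathcal{G}$ is simple, undirected and unweighted, and $d_i$ is the degree of node $i$. The degrees are counted with multiplicity: $\Delta_1\ge\Delta_2$ are the first two entries of the degree sequence sorted in non-increasing order, so $\Delta_1=\Delta_2$ when the node of largest degree is not unique. For a set $\mathfrak{D}\subseteq\mathcal{V}$ of defense nodes, $D_y=\mathrm{diag}(y)$ with $y_i=1$ if $i\in\mathfrak{D}$ and $y_i=0$ otherwise, and $H=I_n+kD_y$. For a set $\mathfrak{F}\subseteq\mathcal{V}$ of attacked nodes the payoff is $$J_1(\mathfrak{F},\mathfrak{D})=\frac12\sum_{i\in\mathfrak{F}}H^{-1}_{ii}d_i+\frac12\sum_{i\in\mathfrak{F}}H^{-1}_{ii},$$ where $H^{-1}_{ii}$ is the $i$-th diagonal element of $H^{-1}$. The game is zero-sum: the attacker chooses $\mathfrak{F}$ to maximize the payoff and the defender simultaneously chooses $\mathfrak{D}$ to minimize it. With one attacked node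 $j$ and one defense node $i$, it is the matrix game $\mathcal{M}_{ij}=J_1(\{j\},\{i\})$. A Nash equilibrium is a (pure-strategy) saddle point, i.e. a pair $(i^*,j^* )$ with $\mathcal{M}_{i^*j}\le\mathcal{M}_{i^*j^*}\le\mathcal{M}_{ij^*}$ for all $i,j\in\mathcal{V}$; the game value is $\mathcal{M}_{i^*j^*}$. *)

theory Defs
  imports "HOL-Analysis.Analysis"
begin

(* The nodes are the elements of a finite type 'v, so V = UNIV, n = CARD('v), and n x n
   matrices indexed by the nodes have type real ^ 'v ^ 'v. *)

definition simple_graph :: "'v set set \<Rightarrow> bool" where
  "simple_graph E \<longleftrightarrow> (\<forall>e\<in>E. card e = 2)"

definition node_degree :: "'v::finite set set \<Rightarrow> 'v \<Rightarrow> nat" where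
  "node_degree E v = card {e \<in> E. v \<in> e}"

definition degree_sequence :: "'v::finite set set \<Rightarrow> nat list" where
  "degree_sequence E = rev (sorted_list_of_multiset (image_mset (node_degree E) (mset_set UNIV)))"

definition Delta1 :: "'v::finite set set \<Rightarrow> nat" where
  "Delta1 E = degree_sequence E ! 0"

(* Meaningful only when there are at least two nodes. *)
definition Delta2 :: "'v::finite set set \<Rightarrow> nat" where
  "Delta2 E = degree_sequence E ! 1"

definition diag :: "real ^ 'v \<Rightarrow> real ^ 'v ^ 'v" where
  "diag y = (\<chi> i j. if i = j then y $ i else 0)"

definition H_mat :: "real \<Rightarrow> 'v::finite set \<Rightarrow> real ^ 'v ^ 'v" where
  "H_mat k D = mat 1 + k *\<^sub>R diag (\<chi> i. if i \<in> D then 1 else 0)"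

definition J1 :: "'v::finite set set \<Rightarrow> real \<Rightarrow> 'v set \<Rightarrow> 'v set \<Rightarrow> real" where
  "J1 E k F D =
     1/2 * (\<Sum>i\<in>F. matrix_inv (H_mat k D) $ i $ i * real (node_degree E i))
     + 1/2 * (\<Sum>i\<in>F. matrix_inv (H_mat k D) $ i $ i)"

(* The row i is the defense node and the column j is the attacked node. *)
definition game_matrix :: "'v::finite set set \<Rightarrow> real \<Rightarrow> 'v \<Rightarrow> 'v \<Rightarrow> real" where
  "game_matrix E k i j = J1 E k {j} {i}"

(* The row player minimizes and the column player maximizes. *)
definition nash_equilibrium :: "('v \<Rightarrow> 'v \<Rightarrow> real) \<Rightarrow> 'v \<Rightarrow> 'v \<Rightarrow> bool" where
  "nash_equilibrium M i' j' \<longleftrightarrow> (\<forall>i j. M i' j \<le> M i' j' \<and> M i' j' \<le> M i j')"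

end

theory Submission
  imports Defs
begin

text \<open>The matrix \<open>H\<close> is diagonal, so defending the attacked node divides its payoff
  \<open>(d + 1) / 2\<close> by \<open>1 + k\<close>, and defending any other node changes nothing
  (\<open>game_matrix_entry\<close>). An equilibrium therefore lies on the diagonal: against a fixed attacked
  node, the defender always gains by moving onto it. On the diagonal the defender has no reason to
  leave, so only the attacker's condition remains: every other node, attacked undefended, must pay
  at most what the defended node pays, which is \<open>(d l + 1) (1 + k) \<le> d i + 1\<close> for all \<open>l \<noteq> i\<close>
  (\<open>nash_equilibrium_iff\<close>).

  Since \<open>k > 0\<close>, this makes \<open>i\<close> the strict maximum of the degree. Among the other nodes the
  binding one has the second largest degree, so the condition is
  \<open>(\<Delta>\<^sub>2 + 1) (1 + k) \<le> \<Delta>\<^sub>1 + 1\<close>, a rearrangement of the bound on \<open>k\<close>. The two entries of the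
  sorted degree sequence are tied to nodes of the graph in \<open>two_largest_degrees\<close>.\<close>

lemma matrix_inv_eqI:
  fixes A B :: "real ^ 'n ^ 'n"
  assumes "A ** B = mat 1" "B ** A = mat 1"
  shows "matrix_inv A = B"
proof -
  have "matrix_inv A ** A = mat 1"
    unfolding matrix_inv_def
    by (rule someI2[of _ B]) (use assms in auto)
  then have "B = matrix_inv A ** (A ** B)"
    by (simp add: matrix_mul_assoc)
  then show ?thesis
    by (simp add: assms(1))
qed

lemma diag_mult: "diag x ** diag y = diag (\<chi> i. x $ i * y $ i)"
  for x y :: "real ^ 'v::finite"
proof -
  have "(\<Sum>l\<in>UNIV. (if i = l then x $ i else 0) * (if l = j then y $ l else 0)) =
      (\<Sum>l\<in>UNIV. if i = l then (if l = j then x $ l * y $ l else 0) else 0)" for i j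
    by (rule sum.cong) auto
  then show ?thesis
    by (simp add: diag_def matrix_matrix_mult_def vec_eq_iff)
qed

lemma matrix_inv_diag:
  fixes x :: "real ^ 'v::finite"
  assumes "\<And>i. x $ i \<noteq> 0"
  shows "matrix_inv (diag x) = diag (\<chi> i. 1 / x $ i)"
proof -
  have "diag (\<chi> i. 1) = (mat 1 :: real ^ 'v ^ 'v)"
    by (simp add: diag_def mat_def vec_eq_iff)
  then show ?thesis
    using assms by (intro matrix_inv_eqI) (simp_all add: diag_mult)
qed

lemma H_mat_eq_diag: "H_mat k D = diag (\<chi> i. 1 + (if i \<in> D then k else 0))"
  by (simp add: H_mat_def diag_def mat_def vec_eq_iff)

lemma game_matrix_entry:
  assumes "k > 0"
  shows "game_matrix E k i j = (real (node_degree E j) + 1) / (if i = j then 2 * (1 + k) else 2)"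
proof -
  have "matrix_inv (H_mat k {i}) = diag (\<chi> l. 1 / (1 + (if l \<in> {i} then k else 0)))"
    using assms unfolding H_mat_eq_diag by (subst matrix_inv_diag) (auto simp: vec_eq_iff)
  then show ?thesis
    using assms by (simp add: game_matrix_def J1_def diag_def field_simps)
qed

lemma nash_equilibrium_iff:
  fixes E :: "'v::finite set set"
  assumes "k > 0"
  shows "nash_equilibrium (game_matrix E k) i j \<longleftrightarrow>
    i = j \<and> (\<forall>l. l \<noteq> i \<longrightarrow> (real (node_degree E l) + 1) * (1 + k) \<le> real (node_degree E i) + 1)"
    (is "?N \<longleftrightarrow> i = j \<and> ?C")
proof (intro iffI conjI)
  assume N: ?N
  show eq: "i = j"
  proof (rule ccontr)
    assume "i \<noteq> j"
    let ?a = "real (node_degree E j) + 1"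
    \<comment> \<open>The defender would gain by moving onto the attacked node.\<close>
    have "game_matrix E k i j \<le> game_matrix E k j j"
      using N by (simp add: nash_equilibrium_def)
    then have "?a \<le> ?a / (1 + k)"
      using \<open>i \<noteq> j\<close> assms by (simp add: game_matrix_entry field_simps)
    then have "?a * k \<le> 0"
      using assms by (simp add: field_simps)
    moreover have "?a * k > 0"
      using assms by (intro mult_pos_pos) auto
    ultimately show False by linarith
  qed
  show ?C
  proof (intro allI impI)
    fix l assume "l \<noteq> i"
    have "game_matrix E k i l \<le> game_matrix E k i i"
      using N eq by (simp add: nash_equilibrium_def)
    then show "(real (node_degree E l) + 1) * (1 + k) \<le> real (node_degree E i) + 1"
      using \<open>l \<noteq> i\<close> assms by (simp add: game_matrix_entry field_simps)
  qed
next
  assume "i = j \<and> ?C"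
  then have eq: "i = j" and C: ?C by auto
  have "game_matrix E k i l \<le> game_matrix E k i i" for l
    using C assms by (cases "l = i") (auto simp: game_matrix_entry field_simps)
  moreover have "game_matrix E k i i \<le> game_matrix E k l i" for l
    using assms by (simp add: game_matrix_entry frac_le)
  ultimately show ?N
    using eq by (simp add: nash_equilibrium_def)
qed

text \<open>Removing one node \<open>v\<close> of largest degree from the node set removes exactly the head of the
  degree sequence, so the next entry is the maximum degree over the remaining nodes. This
  counts multiplicities correctly when several nodes have the largest degree.\<close>

lemma two_largest_degrees:
  fixes E :: "'v::finite set set"
  assumes "CARD('v) \<ge> 2"
  obtains v u where "u \<noteq> v" "node_degree E v = Delta1 E" "node_degree E u = Delta2 E"
    "\<And>w. w \<noteq> v \<Longrightarrow> node_degree E w \<le> Delta2 E" "Delta2 E \<le> Delta1 E"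
proof -
  let ?d = "node_degree E" and ?s = "degree_sequence E"
  have ms: "mset ?s = image_mset ?d (mset_set UNIV)"
    by (simp add: degree_sequence_def)
  then have "length ?s = CARD('v)"
    by (metis size_image_mset size_mset size_mset_set)
  then obtain a b r where s: "?s = a # b # r"
    using assms by (metis One_nat_def Suc_1 Suc_le_length_iff)
  have "sorted (rev ?s)"
    by (simp add: degree_sequence_def)
  then have dec: "b \<le> a" "\<And>x. x \<in> set r \<Longrightarrow> x \<le> b"
    unfolding s by (auto simp: sorted_append)
  have ab: "a = Delta1 E" "b = Delta2 E"
    by (simp_all add: Delta1_def Delta2_def s)
  have "a \<in># image_mset ?d (mset_set UNIV)"
    by (simp flip: ms add: s)
  then obtain v where v: "?d v = a"
    by auto
  have "mset_set UNIV = add_mset v (mset_set (UNIV - {v}))"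
    by (simp add: mset_set.remove)
  then have rest: "image_mset ?d (mset_set (UNIV - {v})) = mset (b # r)"
    using ms v by (simp add: s)
  have img: "?d ` (UNIV - {v}) = insert b (set r)"
    using arg_cong[OF rest, of set_mset] by simp
  then have "b \<in> ?d ` (UNIV - {v})"
    by simp
  then obtain u where u: "u \<noteq> v" "?d u = b"
    by blast
  have "?d w \<le> b" if "w \<noteq> v" for w
  proof -
    have "?d w \<in> insert b (set r)"
      using that by (simp flip: img)
    then show ?thesis
      using dec by auto
  qed
  then show thesis
    using that[of u v] u v dec(1) unfolding ab by simp
qed

theorem proposition2:
  fixes E :: "'v::finite set set" and k :: real
  assumes "simple_graph E" and "CARD('v) \<ge> 2" and "k > 0"
  shows "((\<exists>i j. nash_equilibrium (game_matrix E k) i j) \<longleftrightarrow>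
            k \<le> (real (Delta1 E) - real (Delta2 E)) / (real (Delta2 E) + 1))
       \<and> (k \<le> (real (Delta1 E) - real (Delta2 E)) / (real (Delta2 E) + 1) \<longrightarrow>
            (\<exists>v. {w. node_degree E w = Delta1 E} = {v}
               \<and> (\<forall>i j. nash_equilibrium (game_matrix E k) i j \<longleftrightarrow> i = v \<and> j = v)
               \<and> game_matrix E k v v = (real (Delta1 E) + 1) / (2 * k + 2)))"
proof -
  let ?d = "\<lambda>w. real (node_degree E w)"
  let ?T = "k \<le> (real (Delta1 E) - real (Delta2 E)) / (real (Delta2 E) + 1)"
  obtain v u where uv: "u \<noteq> v" and v: "node_degree E v = Delta1 E"
    and u: "node_degree E u = Delta2 E"
    and le2: "\<And>w. w \<noteq> v \<Longrightarrow> node_degree E w \<le> Delta2 E" and le: "Delta2 E \<le> Delta1 E"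
    by (rule two_largest_degrees[OF assms(2), of E]) blast
  have le1: "node_degree E w \<le> Delta1 E" for w
    using le2[of w] le v by (cases "w = v") auto
  have T: "?T \<longleftrightarrow> (real (Delta2 E) + 1) * (1 + k) \<le> real (Delta1 E) + 1"
    by (simp add: pos_le_divide_eq algebra_simps)
  \<comment> \<open>A factor \<open>1 + k > 1\<close> leaves no room for ties.\<close>
  have strict: "node_degree E l < node_degree E i" if "(?d l + 1) * (1 + k) \<le> ?d i + 1" for l i
  proof -
    have "(?d l + 1) * k > 0"
      using assms(3) by (intro mult_pos_pos) auto
    then have "?d l < ?d i"
      using that by (simp add: algebra_simps)
    then show ?thesis by simp
  qed
  have nash: "nash_equilibrium (game_matrix E k) i j \<longleftrightarrow> i = v \<and> j = v \<and> ?T" for i j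
  proof
    assume "nash_equilibrium (game_matrix E k) i j"
    then have ij: "i = j" and C: "\<And>l. l \<noteq> i \<Longrightarrow> (?d l + 1) * (1 + k) \<le> ?d i + 1"
      unfolding nash_equilibrium_iff[OF assms(3)] by auto
    have "i = v"
      using strict[OF C, of v] le1[of i] v by force
    then show "i = v \<and> j = v \<and> ?T"
      using ij C[of u] uv u v T by simp
  next
    assume R: "i = v \<and> j = v \<and> ?T"
    have "(?d l + 1) * (1 + k) \<le> ?d v + 1" if "l \<noteq> v" for l
    proof -
      have "(?d l + 1) * (1 + k) \<le> (real (Delta2 E) + 1) * (1 + k)"
        using le2[OF that] assms(3) by (intro mult_right_mono) auto
      then show ?thesis
        using R T v by linarith
    qed
    then show "nash_equilibrium (game_matrix E k) i j"
      using R unfolding nash_equilibrium_iff[OF assms(3)] by blast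
  qed
  have unique: "{w. node_degree E w = Delta1 E} = {v}" if ?T
  proof -
    have "Delta2 E < Delta1 E"
      using strict[of u v] that T u v by simp
    then have "node_degree E w \<noteq> Delta1 E" if "w \<noteq> v" for w
      using le2[OF that] by simp
    then show ?thesis
      using v by blast
  qed
  have "game_matrix E k v v = (real (Delta1 E) + 1) / (2 * k + 2)"
    using game_matrix_entry[OF assms(3), of E v v] v by (simp add: algebra_simps)
  then show ?thesis
    using nash unique by blast
qed

end
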